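(* Let $X$ be a complex Banach space, canonically embedded in its bidual $X^{**}$, and let $x\in X$ be a point of norm-weak upper semi-continuity for the preduality mapping of $X^{**}$. Then for every $\tau\in X^{**}$, $$\lim_{t\to0^+}\frac{\|x+t\tau\|-\|x\|}{t}=\sup\{\mathrm{Re}\,\tau(f): f\in\partial_x\},$$ where $\partial_x=\{f\in X^*:\|f\|=1,\ f(x)=\|x\|\}$.
   Context: The norms on the left are taken in $X^{**}$. $X^*_1$ is the closed unit ball of $X^*$. A functional $\Lambda\in X^{**}$ that attains its norm at some point of $X^*_1$ is a point of norm-weak upper semi-continuity for the preduality map of $X^{**}$ if for every weak neighbourhood $V$ of $0$ in $X^*$ there is a $\delta>0$ such that for every $\Lambda'\in X^{**}$ with $\|\Lambda'-\Lambda\|<\delta$, $$\{g\in X^*_1:\Lambda'(g)=\|\Lambda'\|\}\subset\{h\in X^*_1:\Lambda(h)=\|\Lambda\|\}+V.$$ An element $x\in X$ is viewed as an element of $X^{**}$ through the canonical embedding. *)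

theory Defs
  imports "HOL-Analysis.Analysis"
begin

text \<open>
  The libraries provide only real normed spaces as type classes.  A complex normed space is a real
  one with a complex scalar multiplication that extends the real one.
\<close>

class complex_normed_vector = real_normed_vector +
  fixes scaleC :: "complex \<Rightarrow> 'a \<Rightarrow> 'a"  (infixr "*\<^sub>C" 75)
  assumes scaleC_add_right: "c *\<^sub>C (x + y) = c *\<^sub>C x + c *\<^sub>C y"
    and scaleC_add_left: "(c + d) *\<^sub>C x = c *\<^sub>C x + d *\<^sub>C x"
    and scaleC_scaleC: "c *\<^sub>C d *\<^sub>C x = (c * d) *\<^sub>C x"
    and scaleC_of_real: "complex_of_real r *\<^sub>C x = r *\<^sub>R x"
    and norm_scaleC: "norm (c *\<^sub>C x) = cmod c * norm x"

class complex_banach = complex_normed_vector + complete_space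

instantiation complex :: complex_banach
begin

definition scaleC_complex :: "complex \<Rightarrow> complex \<Rightarrow> complex" where
  "scaleC_complex c x = c * x"

instance
  by standard (simp_all add: scaleC_complex_def algebra_simps norm_mult scaleR_conv_of_real)

end

text \<open>
  The bounded complex-linear functionals, with the norm inherited from the bounded real-linear
  maps into the complex numbers, that is, the operator norm.
\<close>

typedef (overloaded) 'a cdual =
  "{f :: 'a::complex_normed_vector \<Rightarrow>\<^sub>L complex. \<forall>c x. blinfun_apply f (c *\<^sub>C x) = c * blinfun_apply f x}"
  morphisms blinfun_of_cdual Abs_cdual
  by (rule exI[of _ 0]) simp

setup_lifting type_definition_cdual

lift_definition cdual_apply :: "'a::complex_normed_vector cdual \<Rightarrow> 'a \<Rightarrow> complex"
  is blinfun_apply .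

lemma cdual_eqI: "(\<And>x. cdual_apply f x = cdual_apply g x) \<Longrightarrow> f = g"
  by transfer (rule blinfun_eqI)

instantiation cdual :: (complex_normed_vector) complex_normed_vector
begin

lift_definition zero_cdual :: "'a cdual" is 0 by simp
lift_definition plus_cdual :: "'a cdual \<Rightarrow> 'a cdual \<Rightarrow> 'a cdual" is "(+)"
  by (simp add: plus_blinfun.rep_eq algebra_simps)
lift_definition minus_cdual :: "'a cdual \<Rightarrow> 'a cdual \<Rightarrow> 'a cdual" is "(-)"
  by (simp add: minus_blinfun.rep_eq algebra_simps)
lift_definition uminus_cdual :: "'a cdual \<Rightarrow> 'a cdual" is uminus
  by (simp add: uminus_blinfun.rep_eq)
lift_definition scaleR_cdual :: "real \<Rightarrow> 'a cdual \<Rightarrow> 'a cdual" is scaleR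
  by (simp add: scaleR_blinfun.rep_eq)
lift_definition norm_cdual :: "'a cdual \<Rightarrow> real" is norm .

lift_definition scaleC_cdual :: "complex \<Rightarrow> 'a cdual \<Rightarrow> 'a cdual"
  is "\<lambda>c f. blinfun_mult_right c o\<^sub>L f"
  by simp

definition dist_cdual :: "'a cdual \<Rightarrow> 'a cdual \<Rightarrow> real" where
  "dist_cdual f g = norm (f - g)"
definition sgn_cdual :: "'a cdual \<Rightarrow> 'a cdual" where
  "sgn_cdual f = inverse (norm f) *\<^sub>R f"
definition uniformity_cdual :: "('a cdual \<times> 'a cdual) filter" where
  "uniformity_cdual = (INF e\<in>{0<..}. principal {(x, y). dist x y < e})"
definition open_cdual :: "'a cdual set \<Rightarrow> bool" where
  "open_cdual U = (\<forall>x\<in>U. \<forall>\<^sub>F (x', y) in uniformity. x' = x \<longrightarrow> y \<in> U)"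

instance
proof
  fix f :: "'a cdual" and c :: complex
  show "norm (c *\<^sub>C f) = cmod c * norm f"
  proof transfer
    fix c :: complex and f :: "'a \<Rightarrow>\<^sub>L complex"
    show "norm (blinfun_mult_right c o\<^sub>L f) = cmod c * norm f"
    proof (cases "c = 0")
      case True
      then have "blinfun_mult_right c o\<^sub>L f = 0"
        by (intro blinfun_eqI) simp
      then show ?thesis using True by simp
    next
      case False
      have *: "norm (blinfun_mult_right d o\<^sub>L g) \<le> cmod d * norm g"
        for d and g :: "'a \<Rightarrow>\<^sub>L complex"
        by (rule norm_blinfun_bound)
          (simp_all add: norm_mult mult.assoc mult_left_mono norm_blinfun)
      have "blinfun_mult_right (inverse c) o\<^sub>L (blinfun_mult_right c o\<^sub>L f) = f"
        using False by (intro blinfun_eqI) (simp add: field_simps)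
      with *[of "inverse c" "blinfun_mult_right c o\<^sub>L f"]
      have "norm f \<le> cmod (inverse c) * norm (blinfun_mult_right c o\<^sub>L f)"
        by simp
      then have "cmod c * norm f \<le> norm (blinfun_mult_right c o\<^sub>L f)"
        using False by (simp add: norm_divide norm_inverse field_simps)
      with *[of c f] show ?thesis by simp
    qed
  qed
qed (unfold dist_cdual_def sgn_cdual_def uniformity_cdual_def open_cdual_def,
    (transfer, auto intro!: blinfun_eqI norm_triangle_ineq
      simp: algebra_simps blinfun.bilinear_simps scaleR_conv_of_real)+)

end

lemma bounded_linear_cdual_apply: "bounded_linear (cdual_apply f)"
  by transfer (rule blinfun.bounded_linear_right)

lemma cdual_apply_scaleC: "cdual_apply f (c *\<^sub>C x) = c * cdual_apply f x"
  by transfer simp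

lemma norm_cdual_eq_onorm: "norm f = onorm (cdual_apply f)"
  by transfer (rule norm_blinfun.rep_eq)

lemma norm_cdual_apply_le: "cmod (cdual_apply f x) \<le> norm f * norm x"
  by transfer (rule norm_blinfun)

lemma canonical_embedding_bounded_linear: "bounded_linear (\<lambda>f. cdual_apply f x)"
proof (rule bounded_linear_intro[where K = "norm x"])
  fix f g :: "'a cdual" and r :: real
  show "cdual_apply (f + g) x = cdual_apply f x + cdual_apply g x"
    by transfer (simp add: plus_blinfun.rep_eq)
  show "cdual_apply (r *\<^sub>R f) x = r *\<^sub>R cdual_apply f x"
    by transfer (simp add: scaleR_blinfun.rep_eq)
  show "cmod (cdual_apply f x) \<le> norm f * norm x"
    by (rule norm_cdual_apply_le)
qed

lemma scaleC_cdual_apply: "cdual_apply (c *\<^sub>C f) x = c * cdual_apply f x"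
  by transfer simp

lift_definition canonical_embedding :: "'a::complex_normed_vector \<Rightarrow> 'a cdual cdual"
  is "\<lambda>x. Blinfun (\<lambda>f. cdual_apply f x)"
  by (simp add: bounded_linear_Blinfun_apply[OF canonical_embedding_bounded_linear]
      scaleC_cdual_apply)

lemma cdual_apply_canonical_embedding: "cdual_apply (canonical_embedding x) f = cdual_apply f x"
  by (simp add: cdual_apply.rep_eq[of "canonical_embedding x"] canonical_embedding.rep_eq
      bounded_linear_Blinfun_apply[OF canonical_embedding_bounded_linear])

definition weak_topology :: "'a::complex_normed_vector topology" where
  "weak_topology = topology_generated_by {cdual_apply \<phi> -` U | \<phi> U. open U}"

definition weak_nhd_0 :: "'a::complex_normed_vector set \<Rightarrow> bool" where
  "weak_nhd_0 V \<longleftrightarrow> (\<exists>U. openin weak_topology U \<and> 0 \<in> U \<and> U \<subseteq> V)"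

text \<open>
  For a functional on \<open>Y\<close>, the preduality map takes values in subsets of the unit ball of \<open>Y\<close>
  itself.  The preduality map of the bidual of \<open>X\<close> is the case where \<open>Y\<close> is the dual of \<open>X\<close>.
\<close>

definition preduality_map :: "'y::complex_normed_vector cdual \<Rightarrow> 'y set" where
  "preduality_map \<Lambda> = {g. norm g \<le> 1 \<and> cdual_apply \<Lambda> g = complex_of_real (norm \<Lambda>)}"

definition attains_norm :: "'y::complex_normed_vector cdual \<Rightarrow> bool" where
  "attains_norm \<Lambda> \<longleftrightarrow> (\<exists>g. norm g \<le> 1 \<and> cmod (cdual_apply \<Lambda> g) = norm \<Lambda>)"

definition norm_weak_usc_point :: "'y::complex_normed_vector cdual \<Rightarrow> bool" where
  "norm_weak_usc_point \<Lambda> \<longleftrightarrow> attains_norm \<Lambda> \<and>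
    (\<forall>V. weak_nhd_0 V \<longrightarrow>
      (\<exists>\<delta>>0. \<forall>\<Lambda>'. norm (\<Lambda>' - \<Lambda>) < \<delta> \<longrightarrow> preduality_map \<Lambda>' \<subseteq> preduality_map \<Lambda> + V))"

definition norming_functionals :: "'a::complex_normed_vector \<Rightarrow> 'a cdual set" where
  "norming_functionals x = {f. norm f = 1 \<and> cdual_apply f x = complex_of_real (norm x)}"

end

theory Submission
  imports Defs
begin

text \<open>
  Each \<open>f\<close> in \<open>\<partial>\<^sub>x\<close> gives \<open>\<parallel>x + t\<tau>\<parallel> \<ge> Re (x + t\<tau>)(f) = \<parallel>x\<parallel> + t Re \<tau>(f)\<close>, so the difference quotients
  dominate the supremum.  Conversely, \<open>x + t\<tau>\<close> need not attain its norm on the unit ball of \<open>X\<^sup>*\<close>, but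
  by the Bishop--Phelps theorem it is within \<open>t\<epsilon>\<close> of some \<open>\<Lambda>\<close> that does, say at \<open>g\<close>.  Upper
  semi-continuity, applied to the weak neighbourhood \<open>{v. |\<tau>(v)| < \<epsilon>}\<close>, moves \<open>g\<close> to some \<open>h \<in> \<partial>\<^sub>x\<close> with
  \<open>|\<tau>(g) - \<tau>(h)| < \<epsilon>\<close>, whence \<open>\<parallel>x + t\<tau>\<parallel> \<le> Re (x + t\<tau>)(g) + 2t\<epsilon> \<le> \<parallel>x\<parallel> + t Re \<tau>(h) + 3t\<epsilon>\<close>.
  The Bishop--Phelps theorem follows from Ekeland's variational principle and the Hahn--Banach theorem.
\<close>

section \<open>Sublinear functionals\<close>

definition sublinear :: "('a::real_vector \<Rightarrow> real) \<Rightarrow> bool" where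
  "sublinear p \<longleftrightarrow> (\<forall>x y. p (x + y) \<le> p x + p y) \<and> (\<forall>t>0. \<forall>x. p (t *\<^sub>R x) \<le> t * p x)"

lemma sublinear_add: "sublinear p \<Longrightarrow> p (x + y) \<le> p x + p y"
  by (simp add: sublinear_def)

lemma sublinear_scale_le: "sublinear p \<Longrightarrow> 0 < t \<Longrightarrow> p (t *\<^sub>R x) \<le> t * p x"
  by (simp add: sublinear_def)

lemma sublinear_0: "sublinear p \<Longrightarrow> p 0 = 0"
  using sublinear_scale_le[of p 2 0] sublinear_scale_le[of p "1/2" 0] by simp

lemma sublinear_scale:
  assumes "sublinear p" "0 \<le> t"
  shows "p (t *\<^sub>R x) = t * p x"
proof (cases "t = 0")
  case True
  then show ?thesis using sublinear_0[OF assms(1)] by simp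
next
  case False
  with assms have t: "t > 0" by simp
  have "p (inverse t *\<^sub>R t *\<^sub>R x) \<le> inverse t * p (t *\<^sub>R x)"
    using t by (intro sublinear_scale_le assms) simp
  then have "t * p x \<le> p (t *\<^sub>R x)"
    using t by (simp add: field_simps)
  with sublinear_scale_le[OF assms(1) t, of x] show ?thesis by simp
qed

lemma sublinear_minus: "sublinear p \<Longrightarrow> - p (- x) \<le> p x"
  using sublinear_add[of p x "- x"] sublinear_0[of p] by simp

lemma convex_cone_ray: "convex_cone ((\<lambda>t. t *\<^sub>R y) ` {0..})"
  unfolding convex_cone_iff
proof (intro conjI ballI allI impI)
  show "0 \<in> (\<lambda>t. t *\<^sub>R y) ` {0..}"
    by (rule image_eqI[of _ _ 0]) simp_all
next
  fix u v assume "u \<in> (\<lambda>t. t *\<^sub>R y) ` {0..}" "v \<in> (\<lambda>t. t *\<^sub>R y) ` {0..}"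
  then obtain s t where "u = s *\<^sub>R y" "v = t *\<^sub>R y" "0 \<le> s" "0 \<le> t" by auto
  then show "u + v \<in> (\<lambda>t. t *\<^sub>R y) ` {0..}"
    by (intro image_eqI[of _ _ "s + t"]) (simp_all add: scaleR_add_left)
next
  fix u and c :: real assume "u \<in> (\<lambda>t. t *\<^sub>R y) ` {0..}" "0 \<le> c"
  then obtain t where "u = t *\<^sub>R y" "0 \<le> t" by auto
  with \<open>0 \<le> c\<close> show "c *\<^sub>R u \<in> (\<lambda>t. t *\<^sub>R y) ` {0..}"
    by (intro image_eqI[of _ _ "c * t"]) simp_all
qed

lemma sublinear_shift_cone:
  fixes p \<phi> :: "'a::real_vector \<Rightarrow> real"
  assumes p: "sublinear p" and C: "convex_cone C"
    and add: "\<And>c d. c \<in> C \<Longrightarrow> d \<in> C \<Longrightarrow> \<phi> c + \<phi> d \<le> \<phi> (c + d)"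
    and scale: "\<And>t c. 0 < t \<Longrightarrow> c \<in> C \<Longrightarrow> t * \<phi> c \<le> \<phi> (t *\<^sub>R c)"
    and le: "\<And>c. c \<in> C \<Longrightarrow> \<phi> c \<le> p c"
  obtains q where "sublinear q" "\<And>u. q u \<le> p u" "\<And>c. c \<in> C \<Longrightarrow> q (- c) \<le> - \<phi> c"
proof
  define q where "q u = (INF c\<in>C. p (u + c) - \<phi> c)" for u
  have C0: "0 \<in> C" by (rule convex_cone_contains_0[OF C])
  have low: "- p (- u) \<le> p (u + c) - \<phi> c" if "c \<in> C" for u c
    using sublinear_add[OF p, of "u + c" "- u"] le[OF that] by (simp add: algebra_simps)
  have q_le: "q u \<le> p (u + c) - \<phi> c" if "c \<in> C" for u c
    unfolding q_def by (rule cINF_lower[OF _ that]) (use low in \<open>force intro!: bdd_belowI2\<close>)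
  have q_ge: "b \<le> q u" if "\<And>c. c \<in> C \<Longrightarrow> b \<le> p (u + c) - \<phi> c" for u b
    unfolding q_def by (rule cINF_greatest) (use that C0 in auto)
  have phi0: "\<phi> 0 \<ge> 0"
    using scale[of "1/2" 0] C0 add[of 0 0] scale[of 2 0] by simp
  show "q u \<le> p u" for u
    using q_le[OF C0, of u] phi0 by simp
  show "q (- c) \<le> - \<phi> c" if "c \<in> C" for c
    using q_le[OF that, of "- c"] sublinear_0[OF p] by simp
  show "sublinear q"
    unfolding sublinear_def
  proof (intro conjI allI impI)
    fix u v
    have "q (u + v) - (p (v + d) - \<phi> d) \<le> q u" if d: "d \<in> C" for d
    proof (rule q_ge)
      fix c assume c: "c \<in> C"
      have "q (u + v) \<le> p (u + v + (c + d)) - \<phi> (c + d)"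
        by (intro q_le convex_cone_add C c d)
      also have "\<dots> \<le> p (u + c) + p (v + d) - (\<phi> c + \<phi> d)"
        using sublinear_add[OF p, of "u + c" "v + d"] add[OF c d] by (simp add: algebra_simps)
      finally show "q (u + v) - (p (v + d) - \<phi> d) \<le> p (u + c) - \<phi> c" by simp
    qed
    then have "q (u + v) - q u \<le> q v"
      by (intro q_ge) (smt (verit))
    then show "q (u + v) \<le> q u + q v" by simp
  next
    fix t :: real and u assume t: "0 < t"
    have "inverse t * q (t *\<^sub>R u) \<le> q u"
    proof (rule q_ge)
      fix c assume c: "c \<in> C"
      have "q (t *\<^sub>R u) \<le> p (t *\<^sub>R u + t *\<^sub>R c) - \<phi> (t *\<^sub>R c)"
        using t by (intro q_le convex_cone_scaleR C c) simp
      also have "\<dots> \<le> t * (p (u + c) - \<phi> c)"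
        using sublinear_scale_le[OF p t, of "u + c"] scale[OF t c] by (simp add: algebra_simps)
      finally show "inverse t * q (t *\<^sub>R u) \<le> p (u + c) - \<phi> c"
        using t by (simp add: field_simps)
    qed
    then show "q (t *\<^sub>R u) \<le> t * q u"
      using t by (simp add: field_simps)
  qed
qed

lemma sublinear_chain_lower_bound:
  fixes p :: "'a::real_vector \<Rightarrow> real"
  assumes ne: "F \<noteq> {}" and sub: "\<And>f. f \<in> F \<Longrightarrow> sublinear f \<and> f \<le> p"
    and chain: "\<And>f g. f \<in> F \<Longrightarrow> g \<in> F \<Longrightarrow> f \<le> g \<or> g \<le> f"
  obtains q where "sublinear q" "\<And>f. f \<in> F \<Longrightarrow> q \<le> f"
proof
  define q where "q u = (INF f\<in>F. f u)" for u
  have low: "- p (- u) \<le> f u" if "f \<in> F" for f u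
    using sublinear_minus[of f u] sub[OF that] le_funD[of f p "- u"] by linarith
  have q_le: "q u \<le> f u" if "f \<in> F" for u f
    unfolding q_def by (rule cINF_lower[OF _ that]) (use low in \<open>force intro!: bdd_belowI2\<close>)
  have q_ge: "b \<le> q u" if "\<And>f. f \<in> F \<Longrightarrow> b \<le> f u" for u b
    unfolding q_def by (rule cINF_greatest) (use that ne in auto)
  show "q \<le> f" if "f \<in> F" for f
    using q_le[OF that] by (simp add: le_fun_def)
  show "sublinear q"
    unfolding sublinear_def
  proof (intro conjI allI impI)
    fix u v
    have *: "q (u + v) \<le> f u + g v" if fg: "f \<in> F" "g \<in> F" for f g
    proof -
      obtain h where h: "h \<in> F" "h \<le> f" "h \<le> g"
        using chain[OF fg] fg by blast
      have "q (u + v) \<le> h (u + v)" by (rule q_le[OF h(1)])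
      also have "\<dots> \<le> h u + h v" using sub[OF h(1)] by (simp add: sublinear_add)
      also have "\<dots> \<le> f u + g v" using h by (simp add: le_fun_def add_mono)
      finally show ?thesis .
    qed
    have "q (u + v) - g v \<le> q u" if "g \<in> F" for g
      by (rule q_ge) (use *[OF _ that] in force)
    then have "q (u + v) - q u \<le> q v"
      by (intro q_ge) (smt (verit))
    then show "q (u + v) \<le> q u + q v" by simp
  next
    fix t :: real and u assume t: "0 < t"
    have "inverse t * q (t *\<^sub>R u) \<le> q u"
    proof (rule q_ge)
      fix f assume f: "f \<in> F"
      have "q (t *\<^sub>R u) \<le> t * f u"
        using q_le[OF f, of "t *\<^sub>R u"] sublinear_scale_le[of f t u] sub[OF f] t by simp
      then show "inverse t * q (t *\<^sub>R u) \<le> f u"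
        using t by (simp add: field_simps)
    qed
    then show "q (t *\<^sub>R u) \<le> t * q u"
      using t by (simp add: field_simps)
  qed
qed

text \<open>A sublinear functional that is minimal in the pointwise order is linear.\<close>

lemma Hahn_Banach_sublinear:
  fixes p :: "'a::real_vector \<Rightarrow> real"
  assumes p: "sublinear p"
  obtains \<theta> where "linear \<theta>" "\<And>x. \<theta> x \<le> p x"
proof -
  define A where "A = {q. sublinear q \<and> q \<le> p}"
  have "\<exists>m\<in>A. \<forall>a\<in>A. a \<le> m \<longrightarrow> a = m"
  proof (rule predicate_Zorn)
    show "partial_order_on A (relation_of (\<lambda>f g. g \<le> f) A)"
      by (rule partial_order_on_relation_ofI) auto
    fix F assume F: "F \<in> Chains (relation_of (\<lambda>f g. g \<le> f) A)"
    show "\<exists>u\<in>A. \<forall>a\<in>F. u \<le> a"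
    proof (cases "F = {}")
      case True
      then show ?thesis using p by (auto simp: A_def)
    next
      case False
      have sub: "sublinear f \<and> f \<le> p" if "f \<in> F" for f
        using F that by (auto simp: Chains_def relation_of_def A_def)
      obtain q where q: "sublinear q" "\<And>f. f \<in> F \<Longrightarrow> q \<le> f"
        by (rule sublinear_chain_lower_bound[OF False, of p])
          (use F sub in \<open>auto simp: Chains_def relation_of_def\<close>)
      moreover have "q \<le> p"
        using False q(2) sub by (meson ex_in_conv order_trans)
      ultimately show ?thesis by (auto simp: A_def)
    qed
  qed
  then obtain m where m: "sublinear m" "m \<le> p"
    and min: "\<And>q. sublinear q \<Longrightarrow> q \<le> m \<Longrightarrow> q = m"
    unfolding A_def by (smt (verit) mem_Collect_eq order_trans)
  have m_minus: "m (- y) = - m y" for y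
  proof -
    define R where "R = (\<lambda>t. t *\<^sub>R y) ` {0..}"
    have R: "convex_cone R"
      unfolding R_def by (rule convex_cone_ray)
    obtain q where q: "sublinear q" "\<And>u. q u \<le> m u" "\<And>c. c \<in> R \<Longrightarrow> q (- c) \<le> - m c"
    proof (rule sublinear_shift_cone[OF m(1) R, of m])
      show "m c + m d \<le> m (c + d)" if "c \<in> R" "d \<in> R" for c d
        using that by (auto simp: R_def scaleR_add_left[symmetric] sublinear_scale[OF m(1)] algebra_simps
            simp del: scaleR_add_left)
      show "t * m c \<le> m (t *\<^sub>R c)" if "0 < t" for t c
        using that by (simp add: sublinear_scale[OF m(1)])
    qed auto
    have "q = m" using q(1,2) by (intro min) (auto simp: le_fun_def)
    moreover have "y \<in> R" by (force simp: R_def intro: image_eqI[of _ _ 1])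
    ultimately have "m (- y) \<le> - m y" using q(3) by blast
    with sublinear_minus[OF m(1), of "- y"] show ?thesis by simp
  qed
  have "linear m"
  proof
    show "m (x + y) = m x + m y" for x y
      using sublinear_add[OF m(1), of x y] sublinear_add[OF m(1), of "x + y" "- y"] m_minus by simp
    show "m (r *\<^sub>R x) = r *\<^sub>R m x" for r x
      using sublinear_scale[OF m(1), of r x] sublinear_scale[OF m(1), of "- r" x] m_minus
      by (cases "r \<ge> 0") simp_all
  qed
  with m(2) show thesis by (intro that) (auto simp: le_fun_def)
qed

theorem Mazur_Orlicz_cone:
  fixes p \<phi> :: "'a::real_vector \<Rightarrow> real"
  assumes "sublinear p" and "convex_cone C"
    and "\<And>c d. c \<in> C \<Longrightarrow> d \<in> C \<Longrightarrow> \<phi> c + \<phi> d \<le> \<phi> (c + d)"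
    and "\<And>t c. 0 < t \<Longrightarrow> c \<in> C \<Longrightarrow> t * \<phi> c \<le> \<phi> (t *\<^sub>R c)"
    and "\<And>c. c \<in> C \<Longrightarrow> \<phi> c \<le> p c"
  obtains \<theta> where "linear \<theta>" "\<And>x. \<theta> x \<le> p x" "\<And>c. c \<in> C \<Longrightarrow> \<phi> c \<le> \<theta> c"
proof -
  obtain q where q: "sublinear q" "\<And>u. q u \<le> p u" "\<And>c. c \<in> C \<Longrightarrow> q (- c) \<le> - \<phi> c"
    using sublinear_shift_cone[of p C \<phi>] assms by blast
  obtain \<theta> where \<theta>: "linear \<theta>" "\<And>x. \<theta> x \<le> q x"
    using Hahn_Banach_sublinear[OF q(1)] by blast
  show thesis
  proof
    show "\<theta> x \<le> p x" for x using \<theta>(2) q(2) order_trans by blast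
    show "\<phi> c \<le> \<theta> c" if "c \<in> C" for c
      using \<theta>(2)[of "- c"] q(3)[OF that] linear_neg[OF \<theta>(1), of c] by simp
  qed (rule \<theta>(1))
qed

section \<open>Ekeland's variational principle\<close>

theorem Ekeland_variational_principle:
  fixes \<phi> :: "'a::metric_space \<Rightarrow> real"
  assumes S: "complete S" "S \<noteq> {}" and cont: "continuous_on S \<phi>" and bdd: "bdd_above (\<phi> ` S)"
    and \<epsilon>: "\<epsilon> > 0"
  obtains g where "g \<in> S" "\<And>f. f \<in> S \<Longrightarrow> \<phi> f \<le> \<phi> g + \<epsilon> * dist f g"
proof -
  define T where "T g = {f \<in> S. \<epsilon> * dist f g \<le> \<phi> f - \<phi> g}" for g
  have T_trans: "h \<in> T f" if "h \<in> T g" "g \<in> T f" for f g h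
    using that dist_triangle[of h f g] \<epsilon> unfolding T_def
    by simp (smt (verit, best) mult_left_mono distrib_left dist_commute)
  have bddT: "bdd_above (\<phi> ` T g)" for g
    by (rule bdd_above_mono[OF bdd]) (auto simp: T_def)
  have step: "\<exists>f. f \<in> T g \<and> (\<forall>h\<in>T g. \<phi> h \<le> \<phi> f + (1/2)^n)" if "g \<in> S" for g n
  proof -
    have "g \<in> T g" using that by (simp add: T_def)
    then have "(SUP h\<in>T g. \<phi> h) - (1/2)^n < (SUP h\<in>T g. \<phi> h)" "T g \<noteq> {}" by auto
    then obtain f where "f \<in> T g" "(SUP h\<in>T g. \<phi> h) - (1/2)^n < \<phi> f"
      using less_cSUP_iff[OF _ bddT, of g] by blast
    moreover have "\<phi> h \<le> (SUP h\<in>T g. \<phi> h)" if "h \<in> T g" for h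
      by (rule cSUP_upper[OF that bddT])
    ultimately show ?thesis by (intro exI[of _ f]) force
  qed
  obtain g0 where g0: "g0 \<in> S" using S by blast
  obtain G where G: "\<And>n. G n \<in> S" "\<And>n. G (Suc n) \<in> T (G n)"
    "\<And>n h. h \<in> T (G n) \<Longrightarrow> \<phi> h \<le> \<phi> (G (Suc n)) + (1/2)^n"
  proof -
    let ?Q = "\<lambda>n g f. f \<in> T g \<and> (\<forall>h\<in>T g. \<phi> h \<le> \<phi> f + (1/2)^n)"
    have "\<exists>G. \<forall>n. G n \<in> S \<and> ?Q n (G n) (G (Suc n))"
    proof (rule dependent_nat_choice)
      show "\<exists>f. f \<in> S \<and> ?Q n g f" if "g \<in> S" for g n
        using step[OF that, of n] by (auto simp: T_def)
    qed (use g0 in blast)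
    with that show thesis by blast
  qed
  have GT: "G m \<in> T (G n)" if "n \<le> m" for m n
    using that
  proof (induction m rule: dec_induct)
    case base
    then show ?case using G(1) by (simp add: T_def)
  next
    case (step m)
    then show ?case using T_trans[OF G(2)] by blast
  qed
  have inc: "incseq (\<lambda>n. \<phi> (G n))"
  proof (rule incseq_SucI)
    fix n
    have "0 \<le> \<epsilon> * dist (G (Suc n)) (G n)" using \<epsilon> by simp
    with G(2)[of n] show "\<phi> (G n) \<le> \<phi> (G (Suc n))" by (simp add: T_def)
  qed
  obtain B where "\<And>n. \<phi> (G n) \<le> B"
    using bdd G(1) by (auto simp: bdd_above_def)
  then have Cphi: "Cauchy (\<lambda>n. \<phi> (G n))"
    using incseq_convergent[OF inc] by (metis LIMSEQ_imp_Cauchy)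
  have "Cauchy G"
    unfolding Cauchy_altdef2
  proof (intro allI impI)
    fix e :: real assume "e > 0"
    then obtain N where N: "\<And>n. n \<ge> N \<Longrightarrow> dist (\<phi> (G n)) (\<phi> (G N)) < e * \<epsilon>"
      using Cphi \<epsilon> unfolding Cauchy_altdef2 by (meson mult_pos_pos)
    have "dist (G n) (G N) < e" if "n \<ge> N" for n
    proof -
      have "\<epsilon> * dist (G n) (G N) < \<epsilon> * e"
        using N[OF that] GT[OF that] by (auto simp: T_def dist_real_def mult.commute)
      with \<epsilon> show ?thesis by simp
    qed
    then show "\<exists>N. \<forall>n\<ge>N. dist (G n) (G N) < e" by blast
  qed
  then obtain g where g: "g \<in> S" "G \<longlonglongrightarrow> g"
    using S(1) G(1) unfolding complete_def by blast
  have lim: "(\<lambda>n. \<phi> (G n)) \<longlonglongrightarrow> \<phi> g"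
    by (rule continuous_on_tendsto_compose[OF cont g(2,1)]) (simp add: G(1))
  have gT: "g \<in> T (G n)" for n
  proof -
    have "\<epsilon> * dist g (G n) \<le> \<phi> g - \<phi> (G n)"
    proof (rule tendsto_le[OF sequentially_bot])
      show "(\<lambda>m. \<phi> (G m) - \<phi> (G n)) \<longlonglongrightarrow> \<phi> g - \<phi> (G n)"
        by (intro tendsto_intros lim)
      show "(\<lambda>m. \<epsilon> * dist (G m) (G n)) \<longlonglongrightarrow> \<epsilon> * dist g (G n)"
        by (intro tendsto_intros g)
      show "\<forall>\<^sub>F m in sequentially. \<epsilon> * dist (G m) (G n) \<le> \<phi> (G m) - \<phi> (G n)"
        using eventually_ge_at_top[of n] by eventually_elim (use GT in \<open>auto simp: T_def\<close>)
    qed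
    with g show ?thesis by (simp add: T_def)
  qed
  show thesis
  proof
    fix f assume f: "f \<in> S"
    show "\<phi> f \<le> \<phi> g + \<epsilon> * dist f g"
    proof (rule ccontr)
      assume contr: "\<not> ?thesis"
      then have "f \<in> T g" using f by (simp add: T_def)
      then have "\<phi> f \<le> \<phi> (G (Suc n)) + (1/2)^n" for n
        using G(3) T_trans[OF _ gT] by blast
      moreover have "(\<lambda>n. \<phi> (G (Suc n)) + (1/2)^n) \<longlonglongrightarrow> \<phi> g + 0"
        by (intro tendsto_add LIMSEQ_Suc[OF lim] LIMSEQ_power_zero) simp
      ultimately have "\<phi> f \<le> \<phi> g"
        by (intro LIMSEQ_le_const[of _ "\<phi> g"]) auto
      moreover have "0 \<le> \<epsilon> * dist f g" using \<epsilon> by simp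
      ultimately show False using contr by simp
    qed
  qed (rule g(1))
qed

section \<open>Complex functionals\<close>

lemma cdual_apply_plus: "cdual_apply (f + g) x = cdual_apply f x + cdual_apply g x"
  by transfer (simp add: plus_blinfun.rep_eq)

lemma cdual_apply_minus: "cdual_apply (f - g) x = cdual_apply f x - cdual_apply g x"
  by transfer (simp add: minus_blinfun.rep_eq)

lemma cdual_apply_scaleR: "cdual_apply (r *\<^sub>R f) x = r *\<^sub>R cdual_apply f x"
  by transfer (simp add: scaleR_blinfun.rep_eq)

lemma complex_eq_of_real_of_norm_le:
  assumes "cmod z \<le> m" "m \<le> Re z"
  shows "z = complex_of_real m"
proof -
  have m: "m = Re z" "cmod z = \<bar>Re z\<bar>"
    using assms complex_Re_le_cmod[of z] abs_Re_le_cmod[of z] by linarith+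
  then have "Im z = 0" using cmod_power2[of z] by simp
  with m show ?thesis by (simp add: complex_eq_iff)
qed

lemma Re_cdual_apply_le: "Re (cdual_apply f x) \<le> norm f * norm x"
  using norm_cdual_apply_le[of f x] complex_Re_le_cmod[of "cdual_apply f x"] by linarith

lemma norm_cdual_bound_Re:
  assumes "0 \<le> M" "\<And>x. Re (cdual_apply f x) \<le> M * norm x"
  shows "norm f \<le> M"
  unfolding norm_cdual_eq_onorm
proof (rule onorm_bound[OF assms(1)])
  fix x
  obtain c where c: "cmod c = 1" "c * cdual_apply f x = complex_of_real (cmod (cdual_apply f x))"
  proof (cases "cdual_apply f x = 0")
    case False
    then show thesis
      by (intro that[of "cnj (cdual_apply f x) / cmod (cdual_apply f x)"])
        (auto simp: norm_divide complex_norm_square[symmetric] power2_eq_square field_simps)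
  qed (use that[of 1] in auto)
  then have "cmod (cdual_apply f x) = Re (cdual_apply f (c *\<^sub>C x))"
    by (simp add: cdual_apply_scaleC)
  also have "\<dots> \<le> M * norm x"
    using assms(2)[of "c *\<^sub>C x"] c by (simp add: norm_scaleC)
  finally show "cmod (cdual_apply f x) \<le> M * norm x" .
qed

lemma cdual_of_real_functional:
  fixes \<theta> :: "'a::complex_normed_vector \<Rightarrow> real"
  assumes lin: "linear \<theta>" and M: "0 \<le> M" "\<And>x. \<theta> x \<le> M * norm x"
  obtains f where "\<And>x. Re (cdual_apply f x) = \<theta> x" "norm f \<le> M"
proof -
  interpret linear \<theta> by fact
  define F where "F x = Complex (\<theta> x) (- \<theta> (\<i> *\<^sub>C x))" for x
  have iC: "\<i> *\<^sub>C (r *\<^sub>R x) = r *\<^sub>R (\<i> *\<^sub>C x)" for r and x :: 'a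
    by (simp add: scaleC_of_real[symmetric] scaleC_scaleC mult.commute)
  have abs: "\<bar>\<theta> x\<bar> \<le> M * norm x" for x
    using M(2)[of x] M(2)[of "- x"] by (simp add: neg)
  have bl: "bounded_linear F"
  proof (rule bounded_linear_intro)
    show "F (x + y) = F x + F y" for x y
      by (simp add: F_def scaleC_add_right add complex_eq_iff)
    show "F (r *\<^sub>R x) = r *\<^sub>R F x" for r x
      by (simp add: F_def iC scaleR complex_eq_iff)
    show "norm (F x) \<le> norm x * (2 * M)" for x
      using abs[of x] abs[of "\<i> *\<^sub>C x"] cmod_le[of "F x"]
      by (simp add: F_def norm_scaleC algebra_simps)
  qed
  have FC: "F (c *\<^sub>C x) = c * F x" for c x
  proof -
    have c: "c *\<^sub>C x = Re c *\<^sub>R x + Im c *\<^sub>R (\<i> *\<^sub>C x)"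
      by (metis complex_eq mult.commute scaleC_add_left scaleC_of_real scaleC_scaleC)
    have ii: "\<i> *\<^sub>C \<i> *\<^sub>C x = - x"
      using scaleC_of_real[of "-1" x] by (simp add: scaleC_scaleC)
    show ?thesis
      unfolding c by (simp add: F_def scaleC_add_right iC ii add diff scaleR neg complex_eq_iff)
  qed
  define f where "f = Abs_cdual (Blinfun F)"
  have f: "cdual_apply f x = F x" for x
    using bl FC by (simp add: f_def cdual_apply.rep_eq Abs_cdual_inverse bounded_linear_Blinfun_apply)
  show thesis
  proof
    show re: "Re (cdual_apply f x) = \<theta> x" for x by (simp add: f F_def)
    show "norm f \<le> M" by (rule norm_cdual_bound_Re) (simp_all add: re M)
  qed
qed

lemma sublinear_norm: "0 \<le> M \<Longrightarrow> sublinear (\<lambda>x::'a::real_normed_vector. M * norm x)"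
  by (simp add: sublinear_def mult_left_mono norm_triangle_ineq distrib_left[symmetric])

lemma norming_functionals_nonempty:
  fixes x :: "'a::complex_normed_vector"
  assumes "x \<noteq> 0"
  shows "norming_functionals x \<noteq> {}"
proof -
  define R where "R = (\<lambda>t. t *\<^sub>R x) ` {0..}"
  have R: "convex_cone R"
    unfolding R_def by (rule convex_cone_ray)
  obtain \<theta> where \<theta>: "linear \<theta>" "\<And>y. \<theta> y \<le> norm y" "\<And>c. c \<in> R \<Longrightarrow> norm c \<le> \<theta> c"
  proof (rule Mazur_Orlicz_cone[OF _ R, of norm norm])
    show "sublinear (norm :: 'a \<Rightarrow> real)" using sublinear_norm[of 1] by simp
    show "norm c + norm d \<le> norm (c + d)" if "c \<in> R" "d \<in> R" for c d
      using that by (auto simp: R_def scaleR_add_left[symmetric] algebra_simps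
          simp del: scaleR_add_left)
  qed auto
  obtain f where f: "\<And>y. Re (cdual_apply f y) = \<theta> y" "norm f \<le> 1"
    using cdual_of_real_functional[of \<theta> 1] \<theta> by auto
  have "x \<in> R" by (force simp: R_def intro: image_eqI[of _ _ 1])
  then have re: "norm x \<le> Re (cdual_apply f x)" using \<theta>(3) f(1) by simp
  have cm: "cmod (cdual_apply f x) \<le> norm x"
    using norm_cdual_apply_le[of f x] f(2) mult_right_mono[of "norm f" 1 "norm x"] by simp
  have "norm x \<le> norm f * norm x"
    using re Re_cdual_apply_le[of f x] by simp
  then have "norm f = 1" using f(2) assms by simp
  moreover have "cdual_apply f x = complex_of_real (norm x)"
    by (rule complex_eq_of_real_of_norm_le[OF cm re])
  ultimately show ?thesis by (auto simp: norming_functionals_def)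
qed

lemma norm_canonical_embedding: "norm (canonical_embedding x) = norm x"
proof (rule antisym)
  show "norm (canonical_embedding x) \<le> norm x"
    by (rule norm_cdual_bound_Re)
      (use Re_cdual_apply_le[of _ x] in \<open>simp_all add: cdual_apply_canonical_embedding mult.commute\<close>)
  show "norm x \<le> norm (canonical_embedding x)"
  proof (cases "x = 0")
    case False
    then obtain f where "norm f = 1" "cdual_apply f x = complex_of_real (norm x)"
      using norming_functionals_nonempty by (auto simp: norming_functionals_def)
    then show ?thesis
      using Re_cdual_apply_le[of "canonical_embedding x" f]
      by (simp add: cdual_apply_canonical_embedding)
  qed simp
qed

instance cdual :: (complex_normed_vector) complex_banach
proof
  fix X :: "nat \<Rightarrow> 'a cdual"
  assume "Cauchy X"
  have dist: "dist (blinfun_of_cdual f) (blinfun_of_cdual g) = dist f g" for f g :: "'a cdual"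
    by (simp add: dist_norm norm_cdual.rep_eq minus_cdual.rep_eq)
  have "Cauchy (\<lambda>n. blinfun_of_cdual (X n))"
    using \<open>Cauchy X\<close> by (simp add: Cauchy_def dist)
  then obtain L where L: "(\<lambda>n. blinfun_of_cdual (X n)) \<longlonglongrightarrow> L"
    using Cauchy_convergent unfolding convergent_def by blast
  have "blinfun_apply L (c *\<^sub>C x) = c * blinfun_apply L x" for c x
  proof (rule LIMSEQ_unique)
    show "(\<lambda>n. blinfun_apply (blinfun_of_cdual (X n)) (c *\<^sub>C x)) \<longlonglongrightarrow> blinfun_apply L (c *\<^sub>C x)"
      by (intro tendsto_intros L)
    have "(\<lambda>n. c * blinfun_apply (blinfun_of_cdual (X n)) x) \<longlonglongrightarrow> c * blinfun_apply L x"
      by (intro tendsto_intros L)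
    then show "(\<lambda>n. blinfun_apply (blinfun_of_cdual (X n)) (c *\<^sub>C x)) \<longlonglongrightarrow> c * blinfun_apply L x"
      using cdual_apply_scaleC[of "X _" c x] by (simp add: cdual_apply.rep_eq)
  qed
  then have "blinfun_of_cdual (Abs_cdual L) = L"
    by (intro Abs_cdual_inverse) simp
  with L have "X \<longlonglongrightarrow> Abs_cdual L"
    by (simp add: tendsto_iff flip: dist)
  then show "convergent X" by (auto simp: convergent_def)
qed

section \<open>The Bishop--Phelps theorem\<close>

theorem Bishop_Phelps:
  fixes \<Lambda> :: "'y::complex_banach cdual"
  assumes \<epsilon>: "\<epsilon> > 0"
  obtains \<Lambda>' where "norm (\<Lambda>' - \<Lambda>) \<le> \<epsilon>" "preduality_map \<Lambda>' \<noteq> {}"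
proof -
  let ?B = "cball (0::'y) 1"
  define \<phi> where "\<phi> u = Re (cdual_apply \<Lambda> u)" for u
  have bl: "bounded_linear \<phi>"
    unfolding \<phi>_def
    by (intro bounded_linear_compose[OF bounded_linear_Re] bounded_linear_cdual_apply)
  interpret \<phi>: bounded_linear \<phi> by (rule bl)
  obtain g where g: "g \<in> ?B" "\<And>f. f \<in> ?B \<Longrightarrow> \<phi> f \<le> \<phi> g + \<epsilon> * dist f g"
  proof (rule Ekeland_variational_principle[of ?B \<phi> \<epsilon>])
    show "complete ?B" by (simp add: complete_eq_closed)
    show "continuous_on ?B \<phi>" by (rule linear_continuous_on[OF bl])
    have "\<phi> u \<le> norm \<Lambda>" if "u \<in> ?B" for u
      using Re_cdual_apply_le[of \<Lambda> u] mult_left_mono[of "norm u" 1 "norm \<Lambda>"] that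
      by (simp add: \<phi>_def)
    then show "bdd_above (\<phi> ` ?B)" by (rule bdd_aboveI2)
  qed (use \<epsilon> in auto)
  define C where "C = conic hull ((\<lambda>f. f - g) ` ?B)"
  have "convex_cone C"
    unfolding C_def convex_cone_def using g(1)
    by (auto simp: conic_hull_eq_empty conic_conic_hull intro!: convex_conic_hull convex_translation_subtract)
  moreover have "\<phi> c \<le> \<epsilon> * norm c" if "c \<in> C" for c
  proof -
    obtain t f where tf: "t \<ge> 0" "f \<in> ?B" "c = t *\<^sub>R (f - g)"
      using \<open>c \<in> C\<close> by (auto simp: C_def conic_hull_explicit)
    have "\<phi> (f - g) \<le> \<epsilon> * norm (f - g)"
      using g(2)[OF tf(2)] by (simp add: \<phi>.diff dist_norm)
    from mult_left_mono[OF this tf(1)] show ?thesis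
      using tf(1) by (simp add: tf(3) \<phi>.scaleR mult.left_commute)
  qed
  ultimately obtain \<theta> where \<theta>: "linear \<theta>" "\<And>u. \<theta> u \<le> \<epsilon> * norm u" "\<And>c. c \<in> C \<Longrightarrow> \<phi> c \<le> \<theta> c"
    using Mazur_Orlicz_cone[OF sublinear_norm, of \<epsilon> C \<phi>] \<epsilon> by (auto simp: \<phi>.add \<phi>.scaleR)
  obtain \<Theta> where \<Theta>: "\<And>u. Re (cdual_apply \<Theta> u) = \<theta> u" "norm \<Theta> \<le> \<epsilon>"
    using cdual_of_real_functional[of \<theta> \<epsilon>] \<theta> \<epsilon> by auto
  define \<Lambda>' where "\<Lambda>' = \<Lambda> - \<Theta>"
  have max: "Re (cdual_apply \<Lambda>' f) \<le> Re (cdual_apply \<Lambda>' g)" if "f \<in> ?B" for f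
  proof -
    have "f - g \<in> C" using that by (auto simp: C_def intro: hull_inc)
    from \<theta>(3)[OF this] show ?thesis
      by (simp add: \<Lambda>'_def cdual_apply_minus \<Theta> \<phi>.diff linear_diff[OF \<theta>(1)] flip: \<phi>_def)
  qed
  let ?m = "Re (cdual_apply \<Lambda>' g)"
  have "norm \<Lambda>' \<le> ?m"
  proof (rule norm_cdual_bound_Re)
    interpret L: bounded_linear "cdual_apply \<Lambda>'" by (rule bounded_linear_cdual_apply)
    show "0 \<le> ?m" using max[of 0] by (simp add: L.zero)
    fix u :: 'y
    show "Re (cdual_apply \<Lambda>' u) \<le> ?m * norm u"
    proof (cases "u = 0")
      case False
      then show ?thesis
        using max[of "u /\<^sub>R norm u"] by (simp add: L.scaleR field_simps)
    qed (simp add: L.zero)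
  qed
  moreover have "cmod (cdual_apply \<Lambda>' g) \<le> norm \<Lambda>'"
    using norm_cdual_apply_le[of \<Lambda>' g] g(1) mult_left_mono[of "norm g" 1 "norm \<Lambda>'"] by simp
  ultimately have "cdual_apply \<Lambda>' g = complex_of_real (norm \<Lambda>')"
    by (intro complex_eq_of_real_of_norm_le)
  with g(1) have "g \<in> preduality_map \<Lambda>'" by (simp add: preduality_map_def)
  moreover have "norm (\<Lambda>' - \<Lambda>) \<le> \<epsilon>" using \<Theta>(2) by (simp add: \<Lambda>'_def)
  ultimately show thesis using that by blast
qed

section \<open>The one-sided derivative of the bidual norm\<close>

lemma bdd_above_norming: "bdd_above ((\<lambda>f. Re (cdual_apply \<tau> f)) ` norming_functionals x)"
proof (rule bdd_aboveI2)
  fix f assume "f \<in> norming_functionals x"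
  then show "Re (cdual_apply \<tau> f) \<le> norm \<tau>"
    using Re_cdual_apply_le[of \<tau> f] by (simp add: norming_functionals_def)
qed

text \<open>
  For \<open>x = 0\<close> the preduality map yields the whole unit ball, but \<open>norming_functionals 0\<close> is only
  the unit sphere.
\<close>

lemma preduality_map_le_SUP_norming:
  fixes x :: "'a::complex_normed_vector"
  assumes nontrivial: "\<exists>y::'a. y \<noteq> 0"
    and h: "h \<in> preduality_map (canonical_embedding x)"
  shows "Re (cdual_apply \<tau> h) \<le> (SUP f \<in> norming_functionals x. Re (cdual_apply \<tau> f))"
    (is "_ \<le> ?S")
proof -
  interpret T: bounded_linear "cdual_apply \<tau>" by (rule bounded_linear_cdual_apply)
  have hx: "norm h \<le> 1" "cdual_apply h x = complex_of_real (norm x)"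
    using h by (auto simp: preduality_map_def cdual_apply_canonical_embedding norm_canonical_embedding)
  have upper: "Re (cdual_apply \<tau> f) \<le> ?S" if "f \<in> norming_functionals x" for f
    by (rule cSUP_upper[OF that bdd_above_norming])
  show ?thesis
  proof (cases "x = 0")
    case False
    have "norm x \<le> norm h * norm x" using norm_cdual_apply_le[of h x] hx by simp
    with False hx show ?thesis by (intro upper) (simp add: norming_functionals_def)
  next
    case True
    interpret F: bounded_linear "cdual_apply f" for f :: "'a cdual" by (rule bounded_linear_cdual_apply)
    have sphere: "f \<in> norming_functionals x" if "norm f = 1" for f
      using that True by (simp add: norming_functionals_def F.zero)
    obtain y :: 'a where "y \<noteq> 0" using nontrivial by blast
    then obtain f :: "'a cdual" where "norm f = 1"
      using norming_functionals_nonempty[of y] by (auto simp: norming_functionals_def)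
    then have "Re (cdual_apply \<tau> f) \<le> ?S" "Re (cdual_apply \<tau> (- f)) \<le> ?S"
      by (simp_all only: upper sphere norm_minus_cancel)
    then have S: "0 \<le> ?S" by (simp add: T.neg)
    show ?thesis
    proof (cases "h = 0")
      case False
      then have "Re (cdual_apply \<tau> (h /\<^sub>R norm h)) \<le> ?S" by (intro upper sphere) simp
      then have "Re (cdual_apply \<tau> h) \<le> norm h * ?S"
        using False by (simp add: T.scaleR field_simps)
      also have "\<dots> \<le> ?S" using hx(1) S by (simp add: mult_left_le_one_le)
      finally show ?thesis .
    qed (simp add: S T.zero)
  qed
qed

lemma weak_nhd_0_functional:
  assumes "\<epsilon> > 0"
  shows "weak_nhd_0 {v. cmod (cdual_apply \<tau> v) < \<epsilon>}"
proof -
  interpret T: bounded_linear "cdual_apply \<tau>" by (rule bounded_linear_cdual_apply)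
  have "openin weak_topology (cdual_apply \<tau> -` ball 0 \<epsilon>)"
    unfolding weak_topology_def by (rule topology_generated_by_Basis) blast
  then show ?thesis
    unfolding weak_nhd_0_def using assms by (intro exI conjI) (auto simp: T.zero)
qed

theorem proposition11:
  fixes x :: "'a::complex_banach" and \<tau> :: "'a cdual cdual"
  assumes nontrivial: "\<exists>y::'a. y \<noteq> 0"
    and usc: "norm_weak_usc_point (canonical_embedding x)"
  shows "((\<lambda>t. (norm (canonical_embedding x + t *\<^sub>R \<tau>) - norm (canonical_embedding x)) / t)
    \<longlongrightarrow> (SUP f \<in> norming_functionals x. Re (cdual_apply \<tau> f))) (at_right 0)"
    (is "(?q \<longlongrightarrow> ?S) _")
proof -
  let ?J = "canonical_embedding x"
  have apply_J: "Re (cdual_apply (?J + t *\<^sub>R \<tau>) f) = Re (cdual_apply f x) + t * Re (cdual_apply \<tau> f)" for t f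
    by (simp add: cdual_apply_plus cdual_apply_scaleR cdual_apply_canonical_embedding)
  have ne: "norming_functionals x \<noteq> {}"
  proof (cases "x = 0")
    case True
    interpret F: bounded_linear "cdual_apply f" for f :: "'a cdual" by (rule bounded_linear_cdual_apply)
    obtain y :: 'a where "y \<noteq> 0" using nontrivial by blast
    from norming_functionals_nonempty[OF this] show ?thesis
      using True by (auto simp: norming_functionals_def F.zero)
  qed (rule norming_functionals_nonempty)
  have lower: "?S \<le> ?q t" if t: "t > 0" for t
  proof (rule cSUP_least[OF ne])
    fix f assume "f \<in> norming_functionals x"
    then have f: "norm f = 1" "cdual_apply f x = complex_of_real (norm x)"
      by (auto simp: norming_functionals_def)
    have "norm x + t * Re (cdual_apply \<tau> f) \<le> norm (?J + t *\<^sub>R \<tau>)"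
      using Re_cdual_apply_le[of "?J + t *\<^sub>R \<tau>" f] f by (simp add: apply_J)
    then show "Re (cdual_apply \<tau> f) \<le> ?q t"
      using t by (simp add: norm_canonical_embedding field_simps)
  qed
  have upper: "\<exists>d>0. \<forall>t. 0 < t \<and> t < d \<longrightarrow> ?q t \<le> ?S + 3 * \<epsilon>" if \<epsilon>: "\<epsilon> > 0" for \<epsilon>
  proof -
    let ?V = "{v. cmod (cdual_apply \<tau> v) < \<epsilon>}"
    obtain \<delta> where \<delta>: "\<delta> > 0"
      "\<And>\<Lambda>. norm (\<Lambda> - ?J) < \<delta> \<Longrightarrow> preduality_map \<Lambda> \<subseteq> preduality_map ?J + ?V"
      using usc weak_nhd_0_functional[OF \<epsilon>] unfolding norm_weak_usc_point_def by blast
    define d where "d = \<delta> / (norm \<tau> + \<epsilon>)"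
    have pos: "norm \<tau> + \<epsilon> > 0" using \<epsilon> by (simp add: add_nonneg_pos)
    have "?q t \<le> ?S + 3 * \<epsilon>" if t: "0 < t" "t < d" for t
    proof -
      let ?L = "?J + t *\<^sub>R \<tau>"
      obtain \<Lambda> g where \<Lambda>: "norm (\<Lambda> - ?L) \<le> t * \<epsilon>" and g: "g \<in> preduality_map \<Lambda>"
        using Bishop_Phelps[of "t * \<epsilon>" ?L] t \<epsilon> by (metis ex_in_conv mult_pos_pos)
      have "norm (\<Lambda> - ?J) \<le> norm (\<Lambda> - ?L) + norm (t *\<^sub>R \<tau>)"
        using norm_triangle_ineq[of "\<Lambda> - ?L" "t *\<^sub>R \<tau>"] by simp
      also have "\<dots> \<le> t * (norm \<tau> + \<epsilon>)" using \<Lambda> t by (simp add: algebra_simps)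
      also have "\<dots> < \<delta>" using t pos by (simp add: d_def field_simps)
      finally obtain h v where h: "h \<in> preduality_map ?J" and v: "cmod (cdual_apply \<tau> v) < \<epsilon>"
        and gh: "g = h + v"
        using \<delta>(2) g by (blast elim: set_plus_elim)
      interpret T: bounded_linear "cdual_apply \<tau>" by (rule bounded_linear_cdual_apply)
      have g1: "norm g \<le> 1" and gL: "Re (cdual_apply \<Lambda> g) = norm \<Lambda>"
        using g by (auto simp: preduality_map_def)
      have ball: "Re (cdual_apply F g) \<le> norm F" for F
        using Re_cdual_apply_le[of F g] mult_left_mono[OF g1, of "norm F"] by simp
      have gx: "Re (cdual_apply g x) \<le> norm x"
        using ball[of ?J] by (simp add: cdual_apply_canonical_embedding norm_canonical_embedding)
      have "Re (cdual_apply \<tau> g) \<le> ?S + \<epsilon>"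
        using preduality_map_le_SUP_norming[OF nontrivial h, of \<tau>] v complex_Re_le_cmod[of "cdual_apply \<tau> v"]
        by (simp add: gh T.add)
      then have tg: "t * Re (cdual_apply \<tau> g) \<le> t * (?S + \<epsilon>)" using t by (simp add: mult_left_mono)
      have "norm ?L \<le> norm \<Lambda> + t * \<epsilon>"
        using \<Lambda> norm_triangle_ineq2[of ?L \<Lambda>] by (simp add: norm_minus_commute)
      also have "norm \<Lambda> = Re (cdual_apply (\<Lambda> - ?L) g) + Re (cdual_apply ?L g)"
        using gL by (simp add: cdual_apply_minus)
      also have "\<dots> \<le> t * \<epsilon> + (norm x + t * (?S + \<epsilon>))"
        using ball[of "\<Lambda> - ?L"] \<Lambda> gx tg by (simp add: apply_J)
      finally have "norm ?L - norm x \<le> t * (?S + 3 * \<epsilon>)" by (simp add: algebra_simps)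
      then show ?thesis using t by (simp add: norm_canonical_embedding field_simps)
    qed
    moreover have "d > 0" using \<delta>(1) pos by (simp add: d_def)
    ultimately show ?thesis by blast
  qed
  show ?thesis
  proof (rule tendstoI)
    fix e :: real assume "e > 0"
    then obtain d where d: "d > 0" "\<And>t. 0 < t \<Longrightarrow> t < d \<Longrightarrow> ?q t \<le> ?S + 3 * (e / 4)"
      using upper[of "e / 4"] by auto
    have "dist (?q t) ?S < e" if "0 < t" "t < d" for t
      using d(2)[OF that] lower[OF that(1)] \<open>e > 0\<close> by (simp add: dist_real_def)
    then show "\<forall>\<^sub>F t in at_right 0. dist (?q t) ?S < e"
      using d(1) by (auto simp: eventually_at_right_field)
  qed
qed

end
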